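(* Let $p$ be a prime, $\alpha\ge 1$ an integer, and $n=p^\alpha$. Let $f:\Delta^{n-1}\to\Delta^{n-1}$ be a continuous map that is pseudo-equivariant, that is, $f(\sigma_{FGZ}(x))=\sigma_{FGZ}(f(x))$ for every pair of proper faces $F,G$ of $\Delta^{n-1}$ of equal dimension, every bijection $Z$ between their sets of zero coordinates, and every $x\in F$. Then there exists $x\in\Delta^{n-1}$ with $f(x)=c$, where $c=(1/n,\dots,1/n)$ is the center of $\Delta^{n-1}$.
   Context: $\Delta^{n-1}=\{(t_1,\dots,t_n)\in\mathbb R^n : t_1,\dots,t_n\ge 0,\ t_1+\dots+t_n=1\}$. For a nonempty set $I\subsetneq\{1,\dots,n\}$, the corresponding (nonempty) proper face is $F_I=\{t\in\Delta^{n-1} : t_i=0 \text{ for all } i\notin I\}$; its "nonzero coordinates" are those indexed by $I$ and its "zero coordinates" are those indexed by $\{1,\dots,n\}\setminus I$. The dimension of $F_I$ is $|I|-1$. Definition of $\sigma_{FGZ}$: let $F=F_I$ and $G=F_J$ be proper faces with $|I|=|J|$ (the case $F=G$ is allowed), and let $Z:\{1,\dots,n\}\setminus I\to\{1,\dots,n\}\setminus J$ be an arbitrary bijection. Let $\pi$ be the permutation of $\{1,\dots,n\}$ which restricts to the unique order-preserving bijection $I\to J$ and which equals $Z$ on $\{1,\dots,n\}\setminus I$. Then $\sigma_{FGZ}:\Delta^{n-1}\to\Delta^{n-1}$ is the permutation of coordinates given by $(\sigma_{FGZ}(t))_{\pi(i)}=t_i$ for all $i$. It maps $F$ onto $G$.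 In the pseudo-equivariance relation, $x$ is required to lie in $F$, but $f(x)$ may be any point of $\Delta^{n-1}$. *)

theory Defs
  imports "HOL-Analysis.Analysis" "HOL-Computational_Algebra.Primes" "HOL-Library.FuncSet"
begin

text \<open>
  The coordinates \<open>{1..n}\<close> are represented by a finite linearly ordered type \<open>'n\<close> with
  \<open>CARD('n) = n\<close>; the order is what the order-preserving bijections refer to.
\<close>

definition std_simplex :: "(real ^ 'n) set" where
  "std_simplex = {t. (\<forall>i. 0 \<le> t $ i) \<and> (\<Sum>i\<in>UNIV. t $ i) = 1}"

definition face :: "'n set \<Rightarrow> (real ^ 'n) set" where
  "face I = {t \<in> std_simplex. \<forall>i. i \<notin> I \<longrightarrow> t $ i = 0}"

definition proper_face_index :: "'n set \<Rightarrow> bool" where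
  "proper_face_index I \<longleftrightarrow> I \<noteq> {} \<and> I \<noteq> UNIV"

text \<open>Being \<open>extensional\<close> makes the function unique as a total function as well.\<close>

definition order_bij :: "'n::linorder set \<Rightarrow> 'n set \<Rightarrow> 'n \<Rightarrow> 'n" where
  "order_bij I J = (THE h. h \<in> extensional I \<and> bij_betw h I J \<and> strict_mono_on I h)"

text \<open>Only the values of \<open>Z\<close> outside \<open>I\<close> matter, so a bijection between the sets of zero
  coordinates is a total function \<open>Z\<close> with \<open>bij_betw Z (- I) (- J)\<close>.\<close>

definition face_perm ::
    "'n::linorder set \<Rightarrow> 'n set \<Rightarrow> ('n \<Rightarrow> 'n) \<Rightarrow> 'n \<Rightarrow> 'n" where
  "face_perm I J Z = (\<lambda>i. if i \<in> I then order_bij I J i else Z i)"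

definition face_sigma ::
    "'n set \<Rightarrow> 'n set \<Rightarrow> ('n \<Rightarrow> 'n) \<Rightarrow>
      real ^ 'n::{finite,linorder} \<Rightarrow> real ^ 'n::{finite,linorder}" where
  "face_sigma I J Z t = (\<chi> j. t $ (inv (face_perm I J Z) j))"

text \<open>Equality of dimensions of the faces is \<open>card I = card J\<close>, as \<open>face I\<close> has dimension
  \<open>card I - 1\<close>.\<close>

definition pseudo_equivariant ::
    "(real ^ 'n::{finite,linorder} \<Rightarrow> real ^ 'n::{finite,linorder}) \<Rightarrow> bool" where
  "pseudo_equivariant f \<longleftrightarrow>
     (\<forall>I J Z. proper_face_index I \<and> proper_face_index J \<and> card I = card J \<and>
        bij_betw Z (- I) (- J) \<longrightarrow>
        (\<forall>x \<in> face I. f (face_sigma I J Z x) = face_sigma I J Z (f x)))"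

lemma order_bij_ex1:
  fixes I J :: "'n::{finite,linorder} set"
  assumes "card I = card J"
  shows "\<exists>!h. h \<in> extensional I \<and> bij_betw h I J \<and> strict_mono_on I h"
proof -
  define xs where "xs = sorted_list_of_set I"
  define ys where "ys = sorted_list_of_set J"
  have xs: "sorted xs" "distinct xs" "set xs = I" "length xs = card I"
    and ys: "sorted ys" "distinct ys" "set ys = J" "length ys = card I"
    unfolding xs_def ys_def using assms by auto
  have sx: "xs ! a < xs ! b" if "a < b" "b < card I" for a b
    using xs that by (metis sorted_wrt_nth_less strict_sorted_iff)
  have sy: "ys ! a < ys ! b" if "a < b" "b < card I" for a b
    using ys that by (metis sorted_wrt_nth_less strict_sorted_iff)
  have bx: "bij_betw ((!) xs) {..<card I} I" and by': "bij_betw ((!) ys) {..<card I} J"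
    using xs ys by (auto intro: bij_betw_nth)
  define r where "r = the_inv_into {..<card I} ((!) xs)"
  have r: "bij_betw r I {..<card I}"
    unfolding r_def using bx by (rule bij_betw_the_inv_into)
  have xr: "xs ! r i = i" if "i \<in> I" for i
    unfolding r_def using bx that by (auto simp: bij_betw_def f_the_inv_into_f)
  have rlt: "r i < card I" if "i \<in> I" for i
    using r that by (auto simp: bij_betw_def)
  have rm: "r i < r j" if "i \<in> I" "j \<in> I" "i < j" for i j
  proof (rule ccontr)
    assume "\<not> r i < r j"
    then have "r j < r i \<or> r j = r i" by auto
    then show False using sx[of "r j" "r i"] xr that rlt by (metis less_asym less_irrefl)
  qed
  define h where "h = restrict (\<lambda>i. ys ! r i) I"
  have h1: "bij_betw h I J"
    using bij_betw_trans[OF r by'] by (simp add: h_def comp_def cong: bij_betw_cong)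
  have h2: "strict_mono_on I h"
    by (rule strict_mono_onI) (simp add: h_def sy rm rlt)
  show ?thesis
  proof (rule ex1I[of _ h])
    show "h \<in> extensional I \<and> bij_betw h I J \<and> strict_mono_on I h"
      using h1 h2 by (simp add: h_def)
    fix g assume g: "g \<in> extensional I \<and> bij_betw g I J \<and> strict_mono_on I g"
    have "sorted_wrt (<) xs" using xs by (simp add: strict_sorted_iff)
    have E: "map k xs = ys" if "bij_betw k I J" "strict_mono_on I k" for k
    proof -
      have "sorted_wrt (<) (map k xs)"
        unfolding sorted_wrt_map
        using \<open>sorted_wrt (<) xs\<close> that(2) xs(3)
        by (auto intro: sorted_wrt_mono_rel[rotated] simp: strict_mono_onD)
      moreover have "set (map k xs) = J"
        using that(1) xs(3) by (simp add: bij_betw_def)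
      ultimately show ?thesis
        using ys by (metis strict_sorted_equal strict_sorted_iff)
    qed
    have "map g xs = map h xs" using E g h1 h2 by metis
    then have "\<And>i. i \<in> I \<Longrightarrow> g i = h i" using xs(3) by auto
    then show "g = h" using g by (auto intro!: extensionalityI[of _ I] simp: h_def)
  qed
qed

lemma order_bij:
  fixes I J :: "'n::{finite,linorder} set"
  assumes "card I = card J"
  shows "bij_betw (order_bij I J) I J" "strict_mono_on I (order_bij I J)"
  using theI'[OF order_bij_ex1[OF assms]] unfolding order_bij_def by auto

lemma bij_face_perm:
  fixes I J :: "'n::{finite,linorder} set"
  assumes "card I = card J" "bij_betw Z (- I) (- J)"
  shows "bij (face_perm I J Z)"
proof -
  have "bij_betw (face_perm I J Z) I J"
    using order_bij(1)[OF assms(1)] by (simp add: face_perm_def cong: bij_betw_cong)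
  moreover have "bij_betw (face_perm I J Z) (- I) (- J)"
    using assms(2) bij_betw_cong[of "- I" "face_perm I J Z" Z "- J"]
    by (simp add: face_perm_def)
  ultimately show ?thesis
    using bij_betw_combine[of _ I J "- I" "- J"] by (simp add: Compl_partition)
qed

lemma face_sigma_nth:
  fixes I J :: "'n::{finite,linorder} set"
  assumes "card I = card J" "bij_betw Z (- I) (- J)"
  shows "face_sigma I J Z t $ face_perm I J Z i = t $ i"
  using bij_face_perm[OF assms] by (simp add: face_sigma_def bij_def)

end

theory Submission
  imports Defs
begin

text \<open>
  Suppose that \<open>f\<close> avoids the center. Label each vertex \<open>v\<close> of a fine iterated barycentric subdivision
  by an index \<open>i\<close> with \<open>f v $ i \<ge> 1 / n\<close>; by compactness some index is small at all vertices of a given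
  small simplex. For an index set \<open>I\<close> let \<open>X I\<close> be the signed number of small simplices of \<open>face I\<close>
  whose labels are exactly \<open>I\<close>. The labelling induces a chain map of the augmented simplicial chain
  complex of the simplex, which is acyclic, so by the Hopf trace formula the alternating sum of the
  \<open>X I\<close> over all \<open>I\<close> vanishes. Here \<open>X {} = 1\<close>, and \<open>X UNIV = 0\<close> because no small simplex carries all
  labels.

  If the label of \<open>v\<close> is taken in the support of \<open>v\<close> whenever possible, then for proper \<open>I\<close> only such
  labels contribute to \<open>X I\<close>: if it is impossible at a vertex \<open>v\<close>, pseudo-equivariance makes all
  coordinates of \<open>f v\<close> outside the support large, and together with the labels \<open>I\<close> of the other
  vertices every index would be large somewhere on the small simplex. Hence \<open>X I\<close> depends only on
  \<open>card I\<close>. As \<open>p\<close> divides \<open>n choose k\<close> for \<open>0 < k < n\<close>, the formula gives \<open>1 \<equiv> 0\<close> modulo \<open>p\<close>.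
\<close>

section \<open>The trace formula for labellings of a subdivided simplex\<close>

text \<open>For \<open>m \<notin> J\<close>, the sign incurred by moving \<open>m\<close> from the
  front of an exterior product to its place among the increasing indices \<open>J\<close>.\<close>

definition shuffle_sign :: "'a::linorder \<Rightarrow> 'a set \<Rightarrow> int" where
  "shuffle_sign m J = (-1) ^ card {j \<in> J. j < m}"

text \<open>\<open>minor ls J\<close> is the coefficient of the basis vector of \<open>J\<close> (indices increasing) in the exterior
  product of the basis vectors listed in \<open>ls\<close>; so it is \<open>\<plusminus>1\<close> if \<open>ls\<close> lists \<open>J\<close> without repetition,
  and \<open>0\<close> otherwise.\<close>

fun minor :: "'a::linorder list \<Rightarrow> 'a set \<Rightarrow> int" where
  "minor [] J = of_bool (J = {})"
| "minor (m # l) J = (if m \<in> J then shuffle_sign m (J - {m}) * minor l (J - {m}) else 0)"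

text \<open>Chains are handled by duality: an integer cochain is any function on vertex lists, and \<open>cobd\<close>
  and \<open>subdiv\<close> are the transposes of the augmented boundary operator and of barycentric subdivision.
  The recursions transpose \<open>\<partial>(v * l) = l - v * \<partial>l\<close> and \<open>sd l = b * sd (\<partial>l)\<close>, with \<open>b\<close> the barycenter
  of \<open>l\<close>.\<close>

fun cobd :: "('v list \<Rightarrow> int) \<Rightarrow> 'v list \<Rightarrow> int" where
  "cobd \<phi> [] = 0"
| "cobd \<phi> (v # l) = \<phi> l - cobd (\<lambda>k. \<phi> (v # k)) l"

fun deletions :: "'v list \<Rightarrow> 'v list set" where
  "deletions [] = {}"
| "deletions (v # l) = insert l ((#) v ` deletions l)"

lemma deletions_length: "k \<in> deletions l \<Longrightarrow> length l = Suc (length k)"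
  by (induction l arbitrary: k) auto

lemma deletions_shorter: "k \<in> deletions l \<Longrightarrow> length k < length l"
  using deletions_length by fastforce

lemma deletions_subset: "k \<in> deletions l \<Longrightarrow> set k \<subseteq> set l"
  by (induction l arbitrary: k) fastforce+

text \<open>Tells the function package that \<open>cobd \<phi> l\<close> evaluates
  \<open>\<phi>\<close> only on lists with one vertex deleted; the termination of
  \<open>subdiv\<close> rests on this.\<close>

lemma cobd_cong [fundef_cong]:
  "l = l' \<Longrightarrow> (\<And>k. k \<in> deletions l' \<Longrightarrow> \<phi> k = \<psi> k) \<Longrightarrow> cobd \<phi> l = cobd \<psi> l'"
proof (induction l arbitrary: l' \<phi> \<psi>)
  case (Cons v l)
  have "cobd (\<lambda>k. \<phi> (v # k)) l = cobd (\<lambda>k. \<psi> (v # k)) l"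
    by (rule Cons.IH) (use Cons.prems in auto)
  then show ?case using Cons.prems by auto
qed simp

lemma cobd_diff: "cobd (\<lambda>k. \<phi> k - \<psi> k) l = cobd \<phi> l - cobd \<psi> l"
  by (induction l arbitrary: \<phi> \<psi>) auto

lemma cobd_mult: "cobd (\<lambda>k. c * \<phi> k) l = c * cobd \<phi> l"
  by (induction l arbitrary: \<phi>) (auto simp: algebra_simps)

lemma cobd_zero: "cobd (\<lambda>k. 0) l = 0"
  using cobd_mult[of 0 "\<lambda>_. 0"] by simp

lemma cobd_map: "cobd \<phi> (map g l) = cobd (\<lambda>k. \<phi> (map g k)) l"
  by (induction l arbitrary: \<phi>) auto

text \<open>Dual form of \<partial> \<partial> = 0.\<close>

lemma cobd_cobd: "cobd (cobd \<phi>) l = 0"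
  by (induction l arbitrary: \<phi>) (auto simp: cobd_diff)

lemma shuffle_sign_square: "shuffle_sign m J * shuffle_sign m J = 1"
  by (simp add: shuffle_sign_def flip: power_mult_distrib)

lemma shuffle_sign_insert:
  "finite J \<Longrightarrow> x \<notin> J \<Longrightarrow>
    shuffle_sign m (insert x J) = (if x < m then - shuffle_sign m J else shuffle_sign m J)"
proof -
  assume "finite J" "x \<notin> J"
  have "{j \<in> insert x J. j < m} = (if x < m then insert x {j \<in> J. j < m} else {j \<in> J. j < m})"
    by auto
  with \<open>finite J\<close> \<open>x \<notin> J\<close> show ?thesis by (simp add: shuffle_sign_def)
qed

text \<open>Relabelling vertices is a chain map: the right-hand side is the coefficient of
  \<open>J\<close> in the boundary of the chain with coefficients \<open>minor l\<close>.\<close>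

lemma cobd_minor:
  fixes J :: "'a::{finite,linorder} set"
  shows "cobd (\<lambda>l. minor l J) l = (\<Sum>m\<in>-J. shuffle_sign m J * minor l (insert m J))"
proof (induction l arbitrary: J)
  case (Cons v l)
  show ?case
  proof (cases "v \<in> J")
    case False
    \<comment> \<open>As \<open>v \<notin> J\<close>, the set \<open>insert m J\<close> contains
      \<open>v\<close> only for \<open>m = v\<close>.\<close>
    have "(\<Sum>m\<in>-J. shuffle_sign m J * minor (v # l) (insert m J))
        = (\<Sum>m\<in>-J. if m = v then minor l J else 0)"
      by (rule sum.cong[OF refl])
         (use False in \<open>auto simp: shuffle_sign_square simp flip: mult.assoc\<close>)
    also have "\<dots> = minor l J" using False by simp
    finally show ?thesis using False by (simp add: cobd_zero)
  next
    case True
    define K where "K = J - {v}"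
    have J: "J = insert v K" "v \<notin> K" using True by (auto simp: K_def)
    have "- K = insert v (- J)" using J by auto
    have "shuffle_sign m J * minor (v # l) (insert m J)
        = - (shuffle_sign v K * (shuffle_sign m K * minor l (insert m K)))" if "m \<in> - J" for m
    proof -
      have "insert m J - {v} = insert m K" using J that by auto
      \<comment> \<open>Exactly one of \<open>v < m\<close> and \<open>m < v\<close> holds, so
        exactly one of the two signs flips.\<close>
      moreover have "shuffle_sign m J * shuffle_sign v (insert m K)
          = - (shuffle_sign v K * shuffle_sign m K)"
        using that J by (auto simp: shuffle_sign_insert)
      ultimately show ?thesis using True by (simp flip: mult.assoc)
    qed
    then have "(\<Sum>m\<in>-J. shuffle_sign m J * minor (v # l) (insert m J))
        = - (shuffle_sign v K * (\<Sum>m\<in>-J. shuffle_sign m K * minor l (insert m K)))"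
      by (simp add: sum_negf sum_distrib_left)
    moreover have "cobd (\<lambda>l. minor (v # l) J) l
        = shuffle_sign v K * (\<Sum>m\<in>-K. shuffle_sign m K * minor l (insert m K))"
      using True by (simp add: cobd_mult Cons.IH K_def)
    moreover have "(\<Sum>m\<in>-K. shuffle_sign m K * minor l (insert m K))
        = shuffle_sign v K * minor l J + (\<Sum>m\<in>-J. shuffle_sign m K * minor l (insert m K))"
      using True unfolding \<open>- K = insert v (- J)\<close> by (simp add: J(1))
    ultimately show ?thesis
      by (simp add: algebra_simps shuffle_sign_square flip: mult.assoc)
  qed
qed simp

text \<open>In an increasing list the position of \<open>i\<close> is the number of smaller entries,
  so the alternating signs are shuffle signs.\<close>

lemma cobd_sorted:
  assumes "sorted_wrt (<) xs"
  shows "cobd \<phi> xs = (\<Sum>i\<in>set xs. shuffle_sign i (set xs - {i}) * \<phi> (remove1 i xs))"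
  using assms
proof (induction xs arbitrary: \<phi>)
  case (Cons x xs)
  have x: "x < y" if "y \<in> set xs" for y using Cons.prems that by simp
  then have xn: "x \<notin> set xs" by blast
  have none: "{j \<in> set xs. j < x} = {}" using x by force
  have 1: "shuffle_sign x (set xs) = 1" unfolding shuffle_sign_def none by simp
  have 2: "shuffle_sign i (insert x (set xs) - {i}) * \<phi> (remove1 i (x # xs))
      = - (shuffle_sign i (set xs - {i}) * \<phi> (x # remove1 i xs))" if "i \<in> set xs" for i
  proof -
    have "insert x (set xs) - {i} = insert x (set xs - {i})" using x[OF that] by auto
    then show ?thesis using x[OF that] xn by (auto simp: shuffle_sign_insert)
  qed
  have "cobd (\<lambda>k. \<phi> (x # k)) xs
      = (\<Sum>i\<in>set xs. shuffle_sign i (set xs - {i}) * \<phi> (x # remove1 i xs))"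
    using Cons by simp
  then show ?case
    using xn 1 sum.cong[OF refl, of "set xs", OF 2] by (simp add: sum_negf del: remove1.simps) simp
qed simp

text \<open>Coning with the least index \<open>r\<close> contracts the augmented simplicial chain complex; pairing \<open>J\<close> with
  \<open>insert r J\<close>, the chain map identities make the alternating trace telescope.\<close>

lemma hopf_trace:
  fixes C :: "'a::{finite,linorder} set \<Rightarrow> 'a set \<Rightarrow> int"
  assumes chain: "\<And>I J. (\<Sum>m\<in>-J. shuffle_sign m J * C I (insert m J))
      = (\<Sum>i\<in>I. shuffle_sign i (I - {i}) * C (I - {i}) J)"
  shows "(\<Sum>I\<in>UNIV. (-1) ^ card I * C I I) = 0"
proof -
  define r :: 'a where "r = Min UNIV"
  have r: "r \<le> x" for x by (simp add: r_def)
  define N where "N = {J. r \<notin> J}"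
  \<comment> \<open>Off-diagonal terms of \<open>chain\<close> for source \<open>insert r J\<close>
    and target \<open>J\<close>: inserting \<open>m\<close> gives \<open>G J m\<close> and deleting
    \<open>i\<close> gives \<open>G (J - {i}) i\<close>, up to sign.\<close>
  define G where "G J m = (-1) ^ card J * (shuffle_sign m J * C (insert r J) (insert m J))" for J m
  have signr: "shuffle_sign r J = 1" for J
    using r by (simp add: shuffle_sign_def leD)
  have step: "(-1) ^ card J * (C (insert r J) (insert r J) - C J J)
      = (\<Sum>i\<in>J. G (J - {i}) i) - (\<Sum>m\<in>- insert r J. G J m)" if "J \<in> N" for J
  proof -
    have rJ: "r \<notin> J" using that by (simp add: N_def)
    have "- J = insert r (- insert r J)" using rJ by auto
    then have "(\<Sum>m\<in>-J. shuffle_sign m J * C (insert r J) (insert m J))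
        = C (insert r J) (insert r J)
          + (\<Sum>m\<in>- insert r J. shuffle_sign m J * C (insert r J) (insert m J))"
      by (simp add: signr)
    moreover have "(\<Sum>i\<in>insert r J. shuffle_sign i (insert r J - {i}) * C (insert r J - {i}) J)
        = C J J - (\<Sum>i\<in>J. shuffle_sign i (J - {i}) * C (insert r (J - {i})) J)"
    proof -
      have "shuffle_sign i (insert r J - {i}) * C (insert r J - {i}) J
          = - (shuffle_sign i (J - {i}) * C (insert r (J - {i})) J)" if "i \<in> J" for i
      proof -
        have "r < i" using r[of i] that rJ by (cases "r = i") auto
        moreover have "insert r J - {i} = insert r (J - {i})" using rJ that by auto
        ultimately show ?thesis using rJ by (simp add: shuffle_sign_insert)
      qed
      then show ?thesis using rJ by (simp add: signr sum_negf)
    qed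
    moreover have "G (J - {i}) i
        = - ((-1) ^ card J * (shuffle_sign i (J - {i}) * C (insert r (J - {i})) J))" if "i \<in> J" for i
    proof -
      have "(-1) ^ card J = - ((-1 :: int) ^ card (J - {i}))"
        using that card.remove[of J i] by (simp del: card_Diff_insert card_Diff_singleton)
      moreover have "insert i (J - {i}) = J" using that by auto
      ultimately show ?thesis unfolding G_def by simp
    qed
    ultimately show ?thesis
      using chain[of J "insert r J"]
      by (simp add: sum_negf G_def flip: sum_distrib_left right_diff_distrib)
         (simp add: algebra_simps)
  qed
  \<comment> \<open>Moving \<open>i\<close> out of \<open>J\<close> matches the two index sets, so
    the off-diagonal terms cancel.\<close>
  have "(\<Sum>J\<in>N. \<Sum>i\<in>J. G (J - {i}) i) = (\<Sum>J\<in>N. \<Sum>m\<in>- insert r J. G J m)"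
    unfolding sum.Sigma[OF finite finite[THEN ballI]]
    by (rule sum.reindex_bij_witness[where j = "\<lambda>(J, i). (J - {i}, i)"
          and i = "\<lambda>(J, i). (insert i J, i)"]) (auto simp: N_def insert_absorb)
  then have 0: "(\<Sum>J\<in>N. (-1) ^ card J * (C (insert r J) (insert r J) - C J J)) = 0"
    by (simp add: step sum_subtractf)
  have inj: "inj_on (insert r) N" by (auto simp: N_def inj_on_def)
  have U: "UNIV = N \<union> insert r ` N"
  proof -
    have "I \<in> insert r ` N" if "r \<in> I" for I
      by (rule image_eqI[of _ _ "I - {r}"]) (use that in \<open>auto simp: N_def\<close>)
    then show ?thesis by (auto simp: N_def)
  qed
  have "(\<Sum>I\<in>UNIV. (-1) ^ card I * C I I)
      = (\<Sum>I\<in>N. (-1) ^ card I * C I I) + (\<Sum>I\<in>insert r ` N. (-1) ^ card I * C I I)"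
    unfolding U by (rule sum.union_disjoint) (auto simp: N_def)
  also have "(\<Sum>I\<in>insert r ` N. (-1) ^ card I * C I I)
      = (\<Sum>I\<in>N. - ((-1) ^ card I * C (insert r I) (insert r I)))"
    by (simp add: sum.reindex[OF inj] o_def, rule sum.cong) (auto simp: N_def)
  finally show ?thesis
    using 0 by (simp add: right_diff_distrib sum_subtractf sum_negf)
qed

section \<open>Barycentric subdivision of cochains\<close>

definition barycenter :: "'v::real_vector list \<Rightarrow> 'v" where
  "barycenter l = (1 / real (length l)) *\<^sub>R sum_list l"

function subdiv :: "('v::real_vector list \<Rightarrow> int) \<Rightarrow> 'v list \<Rightarrow> int" where
  "subdiv \<phi> [] = \<phi> []"
| "subdiv \<phi> (v # l) = cobd (\<lambda>k. subdiv (\<lambda>k'. \<phi> (barycenter (v # l) # k')) k) (v # l)"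
  by pat_completeness auto
termination
proof (relation "inv_image less_than (\<lambda>(\<phi>, l). length l)")
  show "((\<lambda>k'. \<phi> (barycenter (v # l) # k'), k), (\<phi>, v # l))
      \<in> inv_image less_than (\<lambda>(\<phi>, l). length l)"
    if "k \<in> deletions (v # l)" for \<phi> :: "'v::real_vector list \<Rightarrow> int" and v l k
    using deletions_shorter[OF that] by simp
qed simp

declare subdiv.simps(2) [simp del]

lemma subdiv_nonempty:
  "l \<noteq> [] \<Longrightarrow> subdiv \<phi> l = cobd (subdiv (\<lambda>k. \<phi> (barycenter l # k))) l"
  by (cases l) (simp, simp only: subdiv.simps(2))

text \<open>The vertex lists at which \<open>subdiv \<phi> l\<close> evaluates
  \<open>\<phi>\<close>: barycenters along a descending flag of faces, largest face first.\<close>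

inductive subsimplex :: "'v::real_vector list \<Rightarrow> 'v list \<Rightarrow> bool" where
  "subsimplex [] []"
| "k \<in> deletions l \<Longrightarrow> subsimplex k' k \<Longrightarrow> subsimplex (barycenter l # k') l"

lemma subdiv_diff: "subdiv (\<lambda>k. \<phi> k - \<psi> k) l = subdiv \<phi> l - subdiv \<psi> l"
proof (induction "length l" arbitrary: l \<phi> \<psi> rule: less_induct)
  case less
  show ?case
  proof (cases "l = []")
    case False
    have "subdiv (\<lambda>k. \<phi> k - \<psi> k) l
       = cobd (\<lambda>k. subdiv (\<lambda>k. \<phi> (barycenter l # k)) k - subdiv (\<lambda>k. \<psi> (barycenter l # k)) k) l"
      unfolding subdiv_nonempty[OF False]
      by (rule cobd_cong[OF refl], rule less) (rule deletions_shorter)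
    then show ?thesis by (simp add: cobd_diff subdiv_nonempty[OF False])
  qed simp
qed

lemma subdiv_cong:
  "(\<And>k. subsimplex k l \<Longrightarrow> \<phi> k = \<psi> k) \<Longrightarrow> subdiv \<phi> l = subdiv \<psi> l"
proof (induction "length l" arbitrary: l \<phi> \<psi> rule: less_induct)
  case less
  show ?case
  proof (cases "l = []")
    case True
    then show ?thesis using less.prems subsimplex.intros(1) by simp
  next
    case False
    show ?thesis
      unfolding subdiv_nonempty[OF False]
    proof (rule cobd_cong[OF refl], rule less.hyps)
      fix k assume k: "k \<in> deletions l"
      show "length k < length l" using deletions_length[OF k] by simp
      show "\<phi> (barycenter l # k') = \<psi> (barycenter l # k')" if "subsimplex k' k" for k'
        by (rule less.prems, rule subsimplex.intros) (use k that in auto)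
    qed
  qed
qed

text \<open>Dually, \<partial> (b * c) = c - b * \<partial> c with c = sd (\<partial> l); by
  induction \<partial> c = sd (\<partial> (\<partial> l)) = 0.\<close>

lemma subdiv_cobd: "subdiv (cobd \<phi>) l = cobd (subdiv \<phi>) l"
proof (induction "length l" arbitrary: l \<phi> rule: less_induct)
  case less
  show ?case
  proof (cases "l = []")
    case False
    define \<psi> where "\<psi> = (\<lambda>k. \<phi> (barycenter l # k))"
    have "subdiv (cobd \<phi>) l = cobd (\<lambda>k. subdiv \<phi> k - subdiv (cobd \<psi>) k) l"
      unfolding subdiv_nonempty[OF False] cobd.simps(2) \<psi>_def by (simp add: subdiv_diff[abs_def])
    also have "\<dots> = cobd (subdiv \<phi>) l - cobd (subdiv (cobd \<psi>)) l"
      by (simp add: cobd_diff)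
    also have "cobd (subdiv (cobd \<psi>)) l = cobd (cobd (subdiv \<psi>)) l"
      by (rule cobd_cong[OF refl], rule less) (rule deletions_shorter)
    finally show ?thesis by (simp add: cobd_cobd)
  qed simp
qed

lemma barycenter_map: "linear g \<Longrightarrow> barycenter (map g l) = g (barycenter l)"
proof -
  assume g: "linear g"
  then have "sum_list (map g l) = g (sum_list l)"
    by (induction l) (auto simp: linear_0 linear_add)
  then show ?thesis by (simp add: barycenter_def linear_scale[OF g])
qed

lemma subdiv_map:
  assumes g: "linear g"
  shows "subdiv \<phi> (map g l) = subdiv (\<lambda>k. \<phi> (map g k)) l"
proof (induction "length l" arbitrary: l \<phi> rule: less_induct)
  case less
  show ?case
  proof (cases "l = []")
    case False
    then have "subdiv \<phi> (map g l)
        = cobd (\<lambda>k. subdiv (\<lambda>k. \<phi> (g (barycenter l) # k)) (map g k)) l"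
      by (simp only: subdiv_nonempty[of "map g l"] map_is_Nil_conv not_False_eq_True cobd_map
          barycenter_map[OF g])
    also have "\<dots> = cobd (\<lambda>k. subdiv (\<lambda>k. \<phi> (g (barycenter l) # map g k)) k) l"
      by (rule cobd_cong[OF refl], rule less.hyps) (rule deletions_shorter)
    also have "\<dots> = subdiv (\<lambda>k. \<phi> (map g k)) l"
      by (simp only: subdiv_nonempty[OF False] list.map)
    finally show ?thesis .
  qed simp
qed

lemma iter_subdiv_Nil: "(subdiv ^^ m) \<phi> [] = \<phi> []"
  by (induction m) auto

lemma iter_subdiv_cobd: "(subdiv ^^ m) (cobd \<phi>) = cobd ((subdiv ^^ m) \<phi>)"
  by (induction m) (auto simp: subdiv_cobd)

lemma iter_subdiv_map:
  assumes g: "linear g"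
  shows "(subdiv ^^ m) \<phi> (map g l) = (subdiv ^^ m) (\<lambda>k. \<phi> (map g k)) l"
  by (induction m arbitrary: l) (simp_all add: subdiv_map[OF g])

lemma iter_subdiv_cong:
  "(\<And>k. (subsimplex ^^ m) k l \<Longrightarrow> \<phi> k = \<psi> k) \<Longrightarrow> (subdiv ^^ m) \<phi> l = (subdiv ^^ m) \<psi> l"
proof (induction m arbitrary: l)
  case (Suc m)
  then show ?case by (auto intro!: subdiv_cong simp: relcompp_apply)
qed simp

lemma iter_subdiv_diff: "(subdiv ^^ m) (\<lambda>k. \<phi> k - \<psi> k) = (\<lambda>l. (subdiv ^^ m) \<phi> l - (subdiv ^^ m) \<psi> l)"
  by (induction m) (auto simp: subdiv_diff)

lemma iter_subdiv_zero: "(subdiv ^^ m) (\<lambda>k. 0) l = 0"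
  using fun_cong[OF iter_subdiv_diff[of m "\<lambda>_. 0" "\<lambda>_. 0"], of l] by simp

lemma iter_subdiv_add: "(subdiv ^^ m) (\<lambda>k. \<phi> k + \<psi> k) l = (subdiv ^^ m) \<phi> l + (subdiv ^^ m) \<psi> l"
  using fun_cong[OF iter_subdiv_diff[of m "\<lambda>k. \<phi> k + \<psi> k" \<psi>], of l] by simp

text \<open>The scalar is \<open>1\<close> or \<open>- 1\<close>, so compatibility with differences
  suffices.\<close>

lemma iter_subdiv_sign:
  "(subdiv ^^ m) (\<lambda>k. shuffle_sign a J * \<phi> k) l = shuffle_sign a J * (subdiv ^^ m) \<phi> l"
proof (cases "shuffle_sign a J = 1")
  case False
  then have "shuffle_sign a J = - 1"
    by (auto simp: shuffle_sign_def neg_one_even_power neg_one_odd_power)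
       (metis neg_one_even_power neg_one_odd_power)
  then show ?thesis
    using fun_cong[OF iter_subdiv_diff[of m "\<lambda>_. 0" \<phi>], of l] by (simp add: iter_subdiv_zero)
qed simp

lemma iter_subdiv_sum:
  "finite A \<Longrightarrow> (subdiv ^^ m) (\<lambda>k. \<Sum>a\<in>A. \<phi> a k) l = (\<Sum>a\<in>A. (subdiv ^^ m) (\<phi> a) l)"
  by (induction A rule: finite_induct) (simp_all add: iter_subdiv_zero iter_subdiv_add)

section \<open>Signed label counts and their alternating sum\<close>

definition face_vertices :: "'n set \<Rightarrow> (real ^ 'n::{finite,linorder}) list" where
  "face_vertices I = map (\<lambda>i. axis i 1) (sorted_list_of_set I)"

lemma cobd_face_vertices:
  "cobd \<phi> (face_vertices I) = (\<Sum>i\<in>I. shuffle_sign i (I - {i}) * \<phi> (face_vertices (I - {i})))"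
  by (simp add: face_vertices_def cobd_map cobd_sorted sorted_list_of_set_remove)

text \<open>The matrix, with source \<open>I\<close> and target \<open>J\<close>, of the chain map
  that subdivides \<open>m\<close> times and then applies the labels; its diagonal enters the trace
  formula.\<close>

definition label_count ::
    "nat \<Rightarrow> (real ^ 'n::{finite,linorder} \<Rightarrow> 'n) \<Rightarrow> 'n set \<Rightarrow> 'n set \<Rightarrow> int" where
  "label_count m lab I J = (subdiv ^^ m) (\<lambda>l. minor (map lab l) J) (face_vertices I)"

text \<open>The chain map identity follows by computing one coboundary twice: on the labels by
  \<open>cobd_minor\<close>, and on the face after exchanging it with subdivision.\<close>

lemma alternating_label_count:
  "(\<Sum>I\<in>UNIV. (-1) ^ card I * label_count m lab I I) = 0"
proof (rule hopf_trace[where C = "label_count m lab"])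
  fix I J
  have "cobd (\<lambda>l. minor (map lab l) J)
      = (\<lambda>l. \<Sum>a\<in>-J. shuffle_sign a J * minor (map lab l) (insert a J))"
    by (rule ext) (simp only: cobd_minor cobd_map[of "\<lambda>l. minor l J" lab, symmetric])
  then have "(\<Sum>a\<in>-J. shuffle_sign a J * label_count m lab I (insert a J))
      = (subdiv ^^ m) (cobd (\<lambda>l. minor (map lab l) J)) (face_vertices I)"
    by (simp add: iter_subdiv_sum iter_subdiv_sign label_count_def)
  also have "\<dots> = (\<Sum>i\<in>I. shuffle_sign i (I - {i}) * label_count m lab (I - {i}) J)"
    by (simp add: iter_subdiv_cobd cobd_face_vertices label_count_def)
  finally show "(\<Sum>a\<in>-J. shuffle_sign a J * label_count m lab I (insert a J))
      = (\<Sum>i\<in>I. shuffle_sign i (I - {i}) * label_count m lab (I - {i}) J)" .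
qed

section \<open>Mesh of iterated barycentric subdivisions\<close>

lemma subsimplex_length: "subsimplex k l \<Longrightarrow> length k = length l"
  by (induction rule: subsimplex.induct) (auto dest: deletions_length)

lemma linear_barycenter:
  fixes h :: "'v::real_vector \<Rightarrow> real"
  assumes "linear h"
  shows "h (barycenter l) = (\<Sum>x\<leftarrow>l. h x) / real (length l)"
proof -
  have "h (sum_list l) = (\<Sum>x\<leftarrow>l. h x)"
    using assms by (induction l) (auto simp: linear_0 linear_add)
  then show ?thesis by (simp add: barycenter_def linear_scale[OF assms])
qed

text \<open>New vertices are convex combinations of old ones; linear functionals express this
  without convex hulls.\<close>

lemma subsimplex_le:
  fixes h :: "'v::real_vector \<Rightarrow> real"
  assumes h: "linear h" and "subsimplex k l" "\<And>v. v \<in> set l \<Longrightarrow> h v \<le> r" "v \<in> set k"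
  shows "h v \<le> r"
  using assms(2-)
proof (induction arbitrary: v rule: subsimplex.induct)
  case (2 k l k')
  have "(\<Sum>x\<leftarrow>l. h x) \<le> (\<Sum>x\<leftarrow>l. r)"
    by (rule sum_list_mono) (use 2 in auto)
  moreover have "length l > 0" using 2 deletions_length by fastforce
  ultimately have "h (barycenter l) \<le> r"
    by (simp add: linear_barycenter[OF h] sum_list_triv field_simps)
  moreover have "h v \<le> r" if "v \<in> set k'"
    using 2 that deletions_subset by blast
  ultimately show ?case using 2 by auto
qed simp

text \<open>The difference of the barycenter and a vertex is an average of differences of vertices,
  one of them zero. The bound \<open>N\<close> on the length keeps the factor fixed when the
  induction passes to faces.\<close>

lemma subsimplex_spread:
  fixes h :: "'v::real_vector \<Rightarrow> real"
  assumes h: "linear h" and "subsimplex k l"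
    and "\<And>v w. v \<in> set l \<Longrightarrow> w \<in> set l \<Longrightarrow> h v - h w \<le> d" "0 \<le> d" "length l \<le> N"
    and "v \<in> set k" "w \<in> set k"
  shows "h v - h w \<le> (1 - 1 / real N) * d"
  using assms(2-)
proof (induction arbitrary: v w rule: subsimplex.induct)
  case (2 k l k')
  define b where "b = barycenter l"
  have len: "length l > 0" using 2 deletions_length by fastforce
  then have N: "N > 0" using 2 by linarith
  have sub: "set k \<subseteq> set l" using 2 deletions_subset by blast
  have near: "s * (h b - h a) \<le> (1 - 1 / real N) * d" if s: "s = 1 \<or> s = - 1" and a: "a \<in> set l" for s a
  proof -
    obtain xs ys where l: "l = xs @ a # ys" using a by (meson split_list)
    have le: "s * (h x - h a) \<le> d" if "x \<in> set l" for x
      using 2(4)[OF that a] 2(4)[OF a that] s by auto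
    have "real (length l) * (s * (h b - h a)) = (\<Sum>x\<leftarrow>l. s * (h x - h a))"
      using len by (simp add: b_def linear_barycenter[OF h] sum_list_const_mult sum_list_subtractf
          sum_list_triv field_simps)
    \<comment> \<open>The summand of \<open>a\<close> itself vanishes, which leaves
      \<open>length l - 1\<close> summands.\<close>
    also have "\<dots> = (\<Sum>x\<leftarrow>xs @ ys. s * (h x - h a))" by (simp add: l)
    also have "\<dots> \<le> (\<Sum>x\<leftarrow>xs @ ys. d)"
      by (rule sum_list_mono) (use le l in auto)
    also have "\<dots> = (real (length l) - 1) * d" by (simp add: l sum_list_triv algebra_simps)
    finally have "s * (h b - h a) \<le> (1 - 1 / real (length l)) * d"
      using len by (simp add: field_simps)
    also have "\<dots> \<le> (1 - 1 / real N) * d"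
      using 2 len by (intro mult_right_mono) (auto simp: frac_le)
    finally show ?thesis .
  qed
  \<comment> \<open>The bounds hold at the vertices of \<open>k\<close> and pass to
    \<open>k'\<close> by convexity.\<close>
  have bv: "h b - h w \<le> (1 - 1 / real N) * d" if w: "w \<in> set k'" for w
  proof -
    have "- h w \<le> (1 - 1 / real N) * d - h b"
      by (rule subsimplex_le[OF linear_compose_neg[OF h] 2(2) _ w])
         (use near[of 1] sub in fastforce)
    then show ?thesis by simp
  qed
  have vb: "h w - h b \<le> (1 - 1 / real N) * d" if w: "w \<in> set k'" for w
  proof -
    have "h w \<le> (1 - 1 / real N) * d + h b"
      by (rule subsimplex_le[OF h 2(2) _ w])
         (use near[of "-1"] sub in fastforce)
    then show ?thesis by simp
  qed
  have "h v - h w \<le> (1 - 1 / real N) * d" if "v \<in> set k'" "w \<in> set k'"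
    by (rule 2(3), (use 2(4) sub in blast))
       (use 2(5,6) that deletions_length[OF 2(1)] in simp_all)
  moreover have "0 \<le> (1 - 1 / real N) * d" using N 2 by simp
  ultimately show ?case
    using 2(7,8) bv vb unfolding b_def by auto
qed simp

lemma iter_subsimplex_le:
  fixes h :: "'v::real_vector \<Rightarrow> real"
  assumes h: "linear h" and "(subsimplex ^^ m) k l" "\<And>v. v \<in> set l \<Longrightarrow> h v \<le> r" "v \<in> set k"
  shows "h v \<le> r"
  using assms(2-)
proof (induction m arbitrary: l)
  case (Suc m)
  then obtain k' where k': "(subsimplex ^^ m) k k'" "subsimplex k' l" by auto
  show ?case by (rule Suc.IH[OF k'(1) subsimplex_le[OF h k'(2)]]) (use Suc in auto)
qed simp

lemma iter_subsimplex_spread: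
  fixes h :: "'v::real_vector \<Rightarrow> real"
  assumes h: "linear h" and "(subsimplex ^^ m) k l"
    and "\<And>v w. v \<in> set l \<Longrightarrow> w \<in> set l \<Longrightarrow> h v - h w \<le> d" "0 \<le> d" "length l \<le> N" "0 < N"
    and "v \<in> set k" "w \<in> set k"
  shows "h v - h w \<le> (1 - 1 / real N) ^ m * d"
  using assms(2-)
proof (induction m arbitrary: l d)
  case (Suc m)
  then obtain k' where k': "(subsimplex ^^ m) k k'" "subsimplex k' l" by auto
  have "h v - h w \<le> (1 - 1 / real N) ^ m * ((1 - 1 / real N) * d)"
    by (rule Suc.IH[OF k'(1) subsimplex_spread[OF h k'(2)]])
       (use Suc subsimplex_length[OF k'(2)] in auto)
  then show ?case by (simp add: mult.assoc mult.left_commute)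
qed simp

lemma set_face_vertices: "set (face_vertices I) = (\<lambda>i. axis i 1) ` I"
  by (simp add: face_vertices_def)

lemma length_face_vertices: "length (face_vertices I) = card I"
  by (simp add: face_vertices_def)

lemma linear_coordinate: "linear (\<lambda>x::real ^ 'n. x $ i)"
  by (rule linearI) auto

lemma axis_in_face: "i \<in> I \<Longrightarrow> axis i 1 \<in> face I"
  by (auto simp: face_def std_simplex_def axis_def)

text \<open>A face is cut out by linear inequalities and equations, and an equation is a pair of
  inequalities.\<close>

lemma iter_subsimplex_in_face:
  assumes k: "(subsimplex ^^ m) k (face_vertices I)" and v: "v \<in> set k"
  shows "v \<in> face I"
proof -
  have up: "h v \<le> r" if "linear h" "\<And>x. x \<in> face I \<Longrightarrow> h x \<le> r" for h and r :: real
    by (rule iter_subsimplex_le[OF that(1) k _ v]) (auto simp: set_face_vertices axis_in_face that(2))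
  have eq: "h v = r" if h: "linear h" "\<And>x. x \<in> face I \<Longrightarrow> h x = r" for h and r :: real
    using up[OF h(1), of r] up[OF linear_compose_neg[OF h(1)], of "- r"] h(2) by fastforce
  have "- (v $ i) \<le> 0" for i
    by (rule up[OF linear_compose_neg[OF linear_coordinate]]) (auto simp: face_def std_simplex_def)
  moreover have "(\<Sum>i\<in>UNIV. v $ i) = 1"
    by (rule eq[OF linear_compose_sum]) (auto simp: face_def std_simplex_def linear_coordinate)
  moreover have "v $ i = 0" if "i \<notin> I" for i
    by (rule eq[OF linear_coordinate]) (use that in \<open>auto simp: face_def\<close>)
  ultimately show ?thesis by (simp add: face_def std_simplex_def)
qed

text \<open>Each coordinate has spread at most \<open>1\<close> at the start and contracts at every
  subdivision; the l1 norm bounds the distance.\<close>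

lemma iter_subsimplex_dist:
  fixes I :: "'n::{finite,linorder} set"
  assumes k: "(subsimplex ^^ m) k (face_vertices I)" and "v \<in> set k" "w \<in> set k"
  shows "dist v w \<le> real CARD('n) * (1 - 1 / real CARD('n)) ^ m"
proof -
  have 1: "v $ i - w $ i \<le> (1 - 1 / real CARD('n)) ^ m * 1"
    if "v \<in> set k" "w \<in> set k" for v w i
    by (rule iter_subsimplex_spread[OF linear_coordinate k])
       (use that in \<open>auto simp: set_face_vertices length_face_vertices axis_def card_mono\<close>)
  have "dist v w \<le> (\<Sum>i\<in>UNIV. \<bar>(v - w) $ i\<bar>)"
    unfolding dist_norm by (rule norm_le_l1_cart)
  also have "\<dots> \<le> (\<Sum>i\<in>(UNIV::'n set). (1 - 1 / real CARD('n)) ^ m)"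
    using 1[OF assms(2,3)] 1[OF assms(3,2)] by (intro sum_mono) (auto simp: abs_le_iff)
  finally show ?thesis by simp
qed

section \<open>Small simplices on which some coordinate of the image is small\<close>

lemma compact_std_simplex: "compact (std_simplex :: (real ^ 'n) set)"
proof (rule compact_eq_bounded_closed[THEN iffD2], intro conjI)
  have "norm t \<le> 1" if "t \<in> std_simplex" for t :: "real ^ 'n"
    using norm_le_l1_cart[of t] that by (simp add: std_simplex_def)
  then show "bounded (std_simplex :: (real ^ 'n) set)" by (auto simp: bounded_iff)
  show "closed (std_simplex :: (real ^ 'n) set)"
    unfolding std_simplex_def
    by (intro closed_Collect_conj closed_Collect_all closed_Collect_le closed_Collect_eq
        continuous_intros)
qed

lemma small_coordinate:
  fixes y :: "real ^ 'n"
  assumes "y \<in> std_simplex" "y \<noteq> (\<chi> i. 1 / real CARD('n))"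
  shows "\<exists>i. y $ i < 1 / real CARD('n)"
proof (rule ccontr)
  assume "\<not> ?thesis"
  then have ge: "1 / real CARD('n) \<le> y $ i" for i by (auto simp: not_less)
  have "(\<Sum>i\<in>UNIV. y $ i - 1 / real CARD('n)) = 0"
    using assms(1) by (simp add: sum_subtractf std_simplex_def)
  then have "y $ i = 1 / real CARD('n)" for i
    using ge by (subst (asm) sum_nonneg_eq_0_iff) auto
  with assms(2) show False by (simp add: vec_eq_iff)
qed

lemma large_coordinate:
  fixes y :: "real ^ 'n"
  assumes "y \<in> std_simplex"
  shows "\<exists>i. 1 / real CARD('n) \<le> y $ i"
proof (rule ccontr)
  assume "\<not> ?thesis"
  then have "(\<Sum>i\<in>UNIV. y $ i) < (\<Sum>i\<in>(UNIV::'n set). 1 / real CARD('n))"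
    by (intro sum_strict_mono) (auto simp: not_le)
  with assms show False by (simp add: std_simplex_def)
qed

text \<open>The sets where a given coordinate of \<open>f\<close> is below \<open>1 / n\<close>
  cover the simplex; the mesh is made smaller than a Lebesgue number of this cover.\<close>

lemma fine_subdivision:
  fixes f :: "real ^ 'n::{finite,linorder} \<Rightarrow> real ^ 'n::{finite,linorder}"
  assumes cont: "continuous_on std_simplex f" and f: "f ` std_simplex \<subseteq> std_simplex"
    and avoid: "\<And>x. x \<in> std_simplex \<Longrightarrow> f x \<noteq> (\<chi> i. 1 / real CARD('n))"
  obtains m where "\<And>I k. (subsimplex ^^ m) k (face_vertices I) \<Longrightarrow>
    \<exists>i. \<forall>v\<in>set k. f v $ i < 1 / real CARD('n)"
proof -
  \<comment> \<open>Continuity on the simplex gives only relatively open sets; the Lebesgue number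
    lemma is applied to open sets of the ambient space.\<close>
  have "\<exists>U. open U \<and> U \<inter> std_simplex = (\<lambda>x. f x $ i) -` {..<1 / real CARD('n)} \<inter> std_simplex"
    for i
    using continuous_on_open_invariant[THEN iffD1, OF continuous_on_component[OF cont, of i]]
    by (metis open_lessThan)
  then obtain U where U: "\<And>i. open (U i)"
      "\<And>i. U i \<inter> std_simplex = (\<lambda>x. f x $ i) -` {..<1 / real CARD('n)} \<inter> std_simplex"
    by metis
  have cover: "std_simplex \<subseteq> \<Union> (range U)"
  proof
    fix x :: "real ^ 'n::{finite,linorder}" assume x: "x \<in> std_simplex"
    then obtain i where "f x $ i < 1 / real CARD('n)"
      using small_coordinate[OF _ avoid[OF x]] f by auto
    then have "x \<in> U i \<inter> std_simplex" using x unfolding U(2) by simp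
    then show "x \<in> \<Union> (range U)" by auto
  qed
  obtain \<delta> where \<delta>: "\<delta> > 0"
    "\<And>T. T \<subseteq> std_simplex \<Longrightarrow> diameter T < \<delta> \<Longrightarrow> \<exists>B\<in>range U. T \<subseteq> B"
    by (rule Lebesgue_number_lemma[OF compact_std_simplex _ cover]) (use U(1) in auto)
  have "(\<lambda>m. (1 - 1 / real CARD('n)) ^ m) \<longlonglongrightarrow> 0"
    by (rule LIMSEQ_realpow_zero) (auto simp: Suc_le_eq)
  then have "(\<lambda>m. real CARD('n) * (1 - 1 / real CARD('n)) ^ m) \<longlonglongrightarrow> real CARD('n) * 0"
    by (rule tendsto_mult_left)
  then have "\<forall>\<^sub>F m in sequentially. real CARD('n) * (1 - 1 / real CARD('n)) ^ m < \<delta>"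
    by (rule order_tendstoD(2)) (simp add: \<delta>(1))
  then obtain m where m: "real CARD('n) * (1 - 1 / real CARD('n)) ^ m < \<delta>"
    by (auto simp: eventually_sequentially)
  show ?thesis
  proof
    fix I and k :: "(real ^ 'n::{finite,linorder}) list"
    assume k: "(subsimplex ^^ m) k (face_vertices I)"
    have "set k \<subseteq> std_simplex" using iter_subsimplex_in_face[OF k] by (auto simp: face_def)
    moreover have "diameter (set k) \<le> real CARD('n) * (1 - 1 / real CARD('n)) ^ m"
      by (rule diameter_le) (auto simp: iter_subsimplex_dist[OF k] simp flip: dist_norm)
    ultimately obtain i where "set k \<subseteq> U i" using \<delta>(2)[of "set k"] m by auto
    with \<open>set k \<subseteq> std_simplex\<close> show "\<exists>i. \<forall>v\<in>set k. f v $ i < 1 / real CARD('n)"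
      using U(2)[of i] by (intro exI[of _ i]) auto
  qed
qed

section \<open>Labels and pseudo-equivariance\<close>

lemma minor_nonzero: "minor ls J \<noteq> 0 \<Longrightarrow> set ls = J"
  by (induction ls arbitrary: J) (auto split: if_splits)

lemma shuffle_sign_image:
  assumes g: "strict_mono_on I g" and "m \<in> I" "J \<subseteq> I"
  shows "shuffle_sign (g m) (g ` J) = shuffle_sign m J"
proof -
  have "{j \<in> g ` J. j < g m} = g ` {j \<in> J. j < m}"
    using assms by (auto simp: strict_mono_on_less)
  moreover have "inj_on g {j \<in> J. j < m}"
    using strict_mono_on_imp_inj_on[OF g] assms(3) by (auto intro: inj_on_subset)
  ultimately show ?thesis by (simp add: shuffle_sign_def card_image)
qed

text \<open>The signs depend only on comparisons within \<open>I\<close>, where \<open>g\<close>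
  preserves the order.\<close>

lemma minor_map:
  assumes g: "strict_mono_on I g" and "set ls \<subseteq> I" "J \<subseteq> I"
  shows "minor (map g ls) (g ` J) = minor ls J"
  using assms(2-)
proof (induction ls arbitrary: J)
  case (Cons m ls)
  have inj: "inj_on g I" using g by (rule strict_mono_on_imp_inj_on)
  have "g ` J - {g m} = g ` (J - {m})"
    using Cons.prems inj by (auto simp: inj_on_def)
  moreover have "g m \<in> g ` J \<longleftrightarrow> m \<in> J"
    using Cons.prems inj by (auto simp: inj_on_def)
  ultimately show ?case
    using Cons.prems by (simp add: Cons.IH shuffle_sign_image[OF g] subset_insertI2 Diff_subset order_trans[OF Diff_subset])
qed auto

lemma Min_image_strict_mono_on:
  assumes g: "strict_mono_on I g" and "A \<subseteq> I" "A \<noteq> {}" "finite A"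
  shows "Min (g ` A) = g (Min A)"
proof (rule Min_eqI)
  have "Min A \<in> A" using assms by simp
  then show "g (Min A) \<in> g ` A" by simp
  fix y assume "y \<in> g ` A"
  then obtain a where a: "a \<in> A" "y = g a" by auto
  then have "Min A \<le> a" using assms by simp
  then show "g (Min A) \<le> y"
    using a \<open>Min A \<in> A\<close> assms(2) strict_mono_on_leD[OF g, of "Min A" a] by auto
qed (use assms in auto)

text \<open>Otherwise \<open>p ^ a\<close> is coprime to the binomial coefficient but divides its
  product with \<open>k\<close>, hence divides \<open>k\<close>.\<close>

lemma prime_dvd_choose_prime_power:
  fixes p a k :: nat
  assumes p: "prime p" and k: "0 < k" "k < p ^ a"
  shows "p dvd (p ^ a choose k)"
proof (rule ccontr)
  assume "\<not> p dvd (p ^ a choose k)"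
  then have "coprime (p ^ a) (p ^ a choose k)"
    using p by (simp add: prime_imp_coprime)
  moreover have "k * (p ^ a choose k) = p ^ a * (p ^ a - 1 choose (k - 1))"
    using k by (simp add: times_binomial_minus1_eq)
  ultimately have "p ^ a dvd k"
    by (metis coprime_dvd_mult_left_iff dvd_triv_left)
  then show False using k by (auto dest: dvd_imp_le)
qed

section \<open>Large coordinates of the image and the support of the point\<close>

definition support :: "real ^ 'n \<Rightarrow> 'n set" where
  "support x = {i. x $ i \<noteq> 0}"

definition high :: "real ^ 'n \<Rightarrow> 'n set" where
  "high y = {i. 1 / real CARD('n) \<le> y $ i}"

text \<open>Choosing the least index inside the support is compatible with the order-preserving bijections
  between faces; the fallback is not, but it never occurs in a simplex that is counted.\<close>

definition label ::
    "(real ^ 'n::{finite,linorder} \<Rightarrow> real ^ 'n::{finite,linorder}) \<Rightarrow>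
      real ^ 'n::{finite,linorder} \<Rightarrow> 'n" where
  "label f x = (if high (f x) \<inter> support x = {} then Min (high (f x)) else Min (high (f x) \<inter> support x))"

lemma high_nonempty: "y \<in> std_simplex \<Longrightarrow> high y \<noteq> {}"
  using large_coordinate by (auto simp: high_def)

lemma support_nonempty: "x \<in> std_simplex \<Longrightarrow> support x \<noteq> {}"
  by (rule ccontr) (simp add: std_simplex_def support_def)

lemma face_support: "x \<in> face I \<Longrightarrow> support x \<subseteq> I \<and> x \<in> face (support x)"
  by (auto simp: face_def support_def)

lemma label_in_high:
  assumes "f x \<in> std_simplex"
  shows "label f x \<in> high (f x)"
proof (cases "high (f x) \<inter> support x = {}")
  case True
  then show ?thesis using Min_in[of "high (f x)"] high_nonempty[OF assms] by (simp add: label_def)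
next
  case False
  then show ?thesis using Min_in[of "high (f x) \<inter> support x"] by (simp add: label_def)
qed

lemma order_bij_self:
  fixes I :: "'n::{finite,linorder} set"
  assumes "i \<in> I"
  shows "order_bij I I i = i"
proof -
  have "restrict id I \<in> extensional I \<and> bij_betw (restrict id I) I I \<and> strict_mono_on I (restrict id I)"
    by (auto simp: bij_betw_def inj_on_def strict_mono_on_def)
  then have "order_bij I I = restrict id I"
    unfolding order_bij_def by (rule the1_equality[OF order_bij_ex1[OF refl]])
  then show ?thesis using assms by simp
qed

lemma high_sigma:
  fixes I J :: "'n::{finite,linorder} set"
  assumes "card I = card J" "bij_betw Z (- I) (- J)"
  shows "high (face_sigma I J Z y) = face_perm I J Z ` high y"
    and "support (face_sigma I J Z y) = face_perm I J Z ` support y"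
proof -
  have *: "\<exists>i. j = face_perm I J Z i" for j
    using bij_face_perm[OF assms] by (metis bij_pointE)
  show "high (face_sigma I J Z y) = face_perm I J Z ` high y"
  proof (intro equalityI subsetI)
    fix j assume "j \<in> high (face_sigma I J Z y)"
    then show "j \<in> face_perm I J Z ` high y"
      using *[of j] by (auto simp: high_def face_sigma_nth[OF assms])
  qed (auto simp: high_def face_sigma_nth[OF assms])
  show "support (face_sigma I J Z y) = face_perm I J Z ` support y"
  proof (intro equalityI subsetI)
    fix j assume "j \<in> support (face_sigma I J Z y)"
    then show "j \<in> face_perm I J Z ` support y"
      using *[of j] by (auto simp: support_def face_sigma_nth[OF assms])
  qed (auto simp: support_def face_sigma_nth[OF assms])
qed

text \<open>Transpositions of zero coordinates of \<open>x\<close> fix \<open>x\<close>, hence \<open>f x\<close> is constant on these coordinates.\<close>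

lemma high_outside_support:
  fixes f :: "real ^ 'n::{finite,linorder} \<Rightarrow> real ^ 'n::{finite,linorder}"
  assumes equiv: "pseudo_equivariant f" and x: "x \<in> face I" "I \<noteq> UNIV" "f x \<in> std_simplex"
    and disj: "high (f x) \<inter> support x = {}"
  shows "- I \<subseteq> high (f x)"
proof
  fix j assume j: "j \<in> - I"
  \<comment> \<open>The support replaces \<open>I\<close> because the large index \<open>i\<close>
    below may lie in \<open>I\<close> outside the support.\<close>
  define K where "K = support x"
  have K: "x \<in> face K" "K \<subseteq> I" "proper_face_index K"
    using face_support[OF x(1)] support_nonempty[of x] x
    by (auto simp: K_def proper_face_index_def face_def)
  obtain i where i: "i \<in> high (f x)" "i \<notin> K" using high_nonempty[OF x(3)] disj by (auto simp: K_def)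
  define Z where "Z = Transposition.transpose i j"
  have Z: "bij_betw Z (- K) (- K)"
    unfolding Z_def
    by (intro permutes_imp_bij permutes_swap_id) (use i j K in auto)
  have fixed: "face_sigma K K Z x = x"
  proof (rule vec_eq_iff[THEN iffD2], rule allI)
    fix a
    show "face_sigma K K Z x $ a = x $ a"
    proof (cases "a \<in> K")
      case True
      then have "face_perm K K Z a = a" by (simp add: face_perm_def order_bij_self)
      then show ?thesis using face_sigma_nth[OF refl Z, of x a] by simp
    next
      case False
      then obtain b where b: "b \<in> - K" "a = Z b"
        using Z by (metis Compl_iff bij_betw_imp_surj_on imageE)
      then have "face_perm K K Z b = a" by (simp add: face_perm_def)
      then have "face_sigma K K Z x $ a = x $ b" using face_sigma_nth[OF refl Z, of x b] by simp
      then show ?thesis using b False by (simp add: K_def support_def)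
    qed
  qed
  have "f x = face_sigma K K Z (f x)"
    using equiv K Z fixed unfolding pseudo_equivariant_def by metis
  then have "high (f x) = face_perm K K Z ` high (f x)"
    using high_sigma(1)[OF refl Z, of "f x"] by simp
  moreover have "face_perm K K Z i = j" using i by (simp add: face_perm_def Z_def)
  ultimately show "j \<in> high (f x)" using i by (metis imageI)
qed

section \<open>Invariance of the label counts\<close>

lemma linear_face_sigma: "linear (face_sigma I J Z)"
  by (rule linearI) (auto simp: face_sigma_def vec_eq_iff)

lemma face_sigma_axis:
  fixes I J :: "'n::{finite,linorder} set"
  assumes "card I = card J" "bij_betw Z (- I) (- J)"
  shows "face_sigma I J Z (axis i 1) = axis (face_perm I J Z i) 1"
proof -
  have "inv (face_perm I J Z) j = i \<longleftrightarrow> j = face_perm I J Z i" for j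
    using bij_face_perm[OF assms] by (metis bij_inv_eq_iff)
  then show ?thesis by (auto simp: face_sigma_def vec_eq_iff axis_def)
qed

text \<open>Since \<open>order_bij I J\<close> preserves the order, the vertex lists agree entry by
  entry and the orientation is kept.\<close>

lemma map_face_sigma_vertices:
  fixes I J :: "'n::{finite,linorder} set"
  assumes "card I = card J" "bij_betw Z (- I) (- J)"
  shows "map (face_sigma I J Z) (face_vertices I) = face_vertices J"
proof -
  let ?g = "order_bij I J"
  have "sorted_wrt (<) (map ?g (sorted_list_of_set I))"
    unfolding sorted_wrt_map
    by (rule sorted_wrt_mono_rel[OF _ strict_sorted_list_of_set])
       (simp add: strict_mono_onD[OF order_bij(2)[OF assms(1)]])
  moreover have "set (map ?g (sorted_list_of_set I)) = J"
    using order_bij(1)[OF assms(1)] by (simp add: bij_betw_def)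
  ultimately have "map ?g (sorted_list_of_set I) = sorted_list_of_set J"
    by (metis finite sorted_list_of_set.idem_if_sorted_distinct strict_sorted_iff)
  moreover have "map (face_sigma I J Z) (face_vertices I)
      = map (\<lambda>i. axis i 1) (map ?g (sorted_list_of_set I))"
    by (auto simp: face_vertices_def face_sigma_axis[OF assms] face_perm_def)
  ultimately show ?thesis by (simp add: face_vertices_def)
qed

text \<open>Subdivision commutes with the linear map carrying \<open>face I\<close> to
  \<open>face J\<close>, so contributions can be compared one small simplex at a time.\<close>

lemma label_count_equivariant:
  fixes f :: "real ^ 'n::{finite,linorder} \<Rightarrow> real ^ 'n::{finite,linorder}"
  assumes equiv: "pseudo_equivariant f" and f: "f ` std_simplex \<subseteq> std_simplex"
    and fine: "\<And>I k. (subsimplex ^^ m) k (face_vertices I) \<Longrightarrow> \<exists>i. \<forall>v\<in>set k. i \<notin> high (f v)"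
    and I: "proper_face_index I" and J: "proper_face_index J" and card: "card I = card J"
  shows "label_count m (label f) J J = label_count m (label f) I I"
proof -
  have "card (- I) = card (- J)" using card by (simp add: Compl_eq_Diff_UNIV card_Diff_subset)
  then obtain Z where Z: "bij_betw Z (- I) (- J)"
    using finite_same_card_bij[of "- I" "- J"] by auto
  define \<pi> where "\<pi> = face_perm I J Z"
  define \<sigma> where "\<sigma> = face_sigma I J Z"
  have inj: "inj \<pi>" unfolding \<pi>_def using bij_face_perm[OF card Z] by (rule bij_is_inj)
  have \<pi>: "\<pi> i = order_bij I J i" if "i \<in> I" for i
    using that by (simp add: \<pi>_def face_perm_def)
  have mono: "strict_mono_on I \<pi>"
    using order_bij(2)[OF card] by (simp add: strict_mono_on_def \<pi>)
  have \<pi>I: "\<pi> ` I = J"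
    using order_bij(1)[OF card] by (simp add: bij_betw_def \<pi> cong: image_cong)
  have "label_count m (label f) J J
      = (subdiv ^^ m) (\<lambda>l. minor (map (label f) (map \<sigma> l)) J) (face_vertices I)"
    unfolding label_count_def map_face_sigma_vertices[OF card Z, symmetric] \<sigma>_def
    by (rule iter_subdiv_map[OF linear_face_sigma])
  also have "\<dots> = label_count m (label f) I I"
    unfolding label_count_def
  proof (rule iter_subdiv_cong)
    fix k assume k: "(subsimplex ^^ m) k (face_vertices I)"
    have face: "v \<in> face I" if "v \<in> set k" for v
      using iter_subsimplex_in_face[OF k that] .
    have fv: "f v \<in> std_simplex" if "v \<in> set k" for v
      using face[OF that] f by (auto simp: face_def)
    have f\<sigma>: "f (\<sigma> v) = \<sigma> (f v)" if "v \<in> set k" for v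
      using equiv I J card Z face[OF that] by (auto simp: pseudo_equivariant_def \<sigma>_def)
    have high\<sigma>: "high (f (\<sigma> v)) = \<pi> ` high (f v)" "support (\<sigma> v) = \<pi> ` support v"
      if "v \<in> set k" for v
      unfolding f\<sigma>[OF that] unfolding \<sigma>_def \<pi>_def by (rule high_sigma[OF card Z])+
    show "minor (map (label f) (map \<sigma> k)) J = minor (map (label f) k) I"
    proof (cases "\<forall>v\<in>set k. high (f v) \<inter> support v \<noteq> {}")
      case True
      have sub: "high (f v) \<inter> support v \<subseteq> I" if "v \<in> set k" for v
        using face_support[OF face[OF that]] by auto
      \<comment> \<open>\<open>\<pi>\<close> need not be monotone outside \<open>I\<close>, but both
        labels are minima of sets on which only its values on \<open>I\<close> matter.\<close>
      have "label f (\<sigma> v) = \<pi> (label f v)" if v: "v \<in> set k" for v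
      proof -
        have "high (f (\<sigma> v)) \<inter> support (\<sigma> v) = \<pi> ` (high (f v) \<inter> support v)"
          unfolding high\<sigma>[OF v] by (simp add: image_Int[OF inj])
        then show ?thesis
          using True v Min_image_strict_mono_on[OF mono sub[OF v]] by (simp add: label_def)
      qed
      then have "map (label f) (map \<sigma> k) = map \<pi> (map (label f) k)" by simp
      moreover have "set (map (label f) k) \<subseteq> I"
      proof -
        have "label f v \<in> I" if v: "v \<in> set k" for v
          using True v Min_in[of "high (f v) \<inter> support v"] sub[OF v] by (auto simp: label_def)
        then show ?thesis by auto
      qed
      ultimately show ?thesis
        using minor_map[OF mono _ subset_refl] \<pi>I by metis
    next
      case False
      then obtain v where v: "v \<in> set k" "high (f v) \<inter> support v = {}" by auto
      obtain i where i: "\<And>w. w \<in> set k \<Longrightarrow> i \<notin> high (f w)" using fine[OF k] by auto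
      have "- I \<subseteq> high (f v)"
        using high_outside_support[OF equiv face[OF v(1)] _ fv[OF v(1)] v(2)] I
        by (simp add: proper_face_index_def)
      \<comment> \<open>The label \<open>i\<close> is then missing from \<open>k\<close> and
        \<open>\<pi> i\<close> from its image, so both minors vanish.\<close>
      then have iI: "i \<in> I" using i[OF v(1)] by auto
      have "i \<notin> set (map (label f) k)"
        using i label_in_high[of f, OF fv] by auto
      then have "minor (map (label f) k) I = 0" using minor_nonzero iI by blast
      moreover have "\<pi> i \<notin> set (map (label f) (map \<sigma> k))"
      proof -
        have "label f (\<sigma> w) \<noteq> \<pi> i" if w: "w \<in> set k" for w
        proof -
          have "high (\<sigma> (f w)) \<noteq> {}"
            using high_nonempty[OF fv[OF w]] high\<sigma>(1)[OF w] f\<sigma>[OF w] by simp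
          then have "label f (\<sigma> w) \<in> \<pi> ` high (f w)"
            using Min_in[of "high (f (\<sigma> w))"] Min_in[of "high (f (\<sigma> w)) \<inter> support (\<sigma> w)"]
            unfolding label_def high\<sigma>(1)[OF w, symmetric] f\<sigma>[OF w] by (auto split: if_splits)
          then show ?thesis using i[OF w] inj_image_mem_iff[OF inj] by metis
        qed
        then show ?thesis by fastforce
      qed
      then have "minor (map (label f) (map \<sigma> k)) J = 0"
        using minor_nonzero iI \<pi>I by blast
      ultimately show ?thesis by simp
    qed
  qed
  finally show ?thesis .
qed

theorem theorem4p1:
  fixes p \<alpha> n :: nat
    and f :: "real ^ 'n::{finite,linorder} \<Rightarrow> real ^ 'n::{finite,linorder}"
  assumes "prime p" and "\<alpha> \<ge> 1" and "n = p ^ \<alpha>" and "CARD('n) = n"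
    and "continuous_on std_simplex f" and "f ` std_simplex \<subseteq> std_simplex"
    and "pseudo_equivariant f"
  shows "\<exists>x \<in> std_simplex. f x = (\<chi> i. 1 / real n)"
proof (rule ccontr)
  assume "\<not> ?thesis"
  then have "f x \<noteq> (\<chi> i. 1 / real CARD('n))" if "x \<in> std_simplex" for x
    using that assms(4) by blast
  from fine_subdivision[OF assms(5,6) this] obtain m where
    "\<And>I k. (subsimplex ^^ m) k (face_vertices I) \<Longrightarrow> \<exists>i. \<forall>v\<in>set k. f v $ i < 1 / real CARD('n)"
    by blast
  then have fine: "\<exists>i. \<forall>v\<in>set k. i \<notin> high (f v)" if "(subsimplex ^^ m) k (face_vertices I)" for I k
    using that by (fastforce simp: high_def not_le)
  define X where "X I = label_count m (label f) I I" for I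
  \<comment> \<open>The empty simplex of the augmented complex supplies the term not divisible by
    \<open>p\<close>.\<close>
  have X_empty: "X {} = 1"
    by (simp add: X_def label_count_def face_vertices_def iter_subdiv_Nil)
  \<comment> \<open>Each label is large at its vertex, but some index is large at no vertex of the
    small simplex.\<close>
  have "X UNIV = (subdiv ^^ m) (\<lambda>_. 0) (face_vertices (UNIV :: 'n set))"
    unfolding X_def label_count_def
  proof (rule iter_subdiv_cong)
    fix k :: "(real ^ 'n::{finite,linorder}) list" assume k: "(subsimplex ^^ m) k (face_vertices UNIV)"
    obtain i where i: "\<And>v. v \<in> set k \<Longrightarrow> i \<notin> high (f v)" using fine[OF k] by auto
    have "label f v \<in> high (f v)" if "v \<in> set k" for v
      by (rule label_in_high) (use iter_subsimplex_in_face[OF k that] assms(6) in \<open>auto simp: face_def\<close>)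
    then have "i \<notin> set (map (label f) k)" using i by auto
    then show "minor (map (label f) k) UNIV = 0" using minor_nonzero by blast
  qed
  then have X_UNIV: "X UNIV = 0" by (simp add: iter_subdiv_zero)
  define P where "P = {I :: 'n set. proper_face_index I}"
  \<comment> \<open>Grouped by size \<open>k\<close>, the proper index sets give
    \<open>n choose k\<close> equal terms with \<open>0 < k < n\<close>.\<close>
  have "int p dvd (\<Sum>I\<in>P. (-1) ^ card I * X I)"
    unfolding sum.image_gen[OF finite, of _ P card]
  proof (rule dvd_sum)
    fix k assume "k \<in> card ` P"
    then obtain K where K: "K \<in> P" "card K = k" by auto
    then have proper: "proper_face_index K" by (simp add: P_def)
    then have k: "0 < k" "k < n"
      using K psubset_card_mono[of UNIV K] assms(4)
      by (auto simp: proper_face_index_def card_gt_0_iff psubset_eq)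
    have "{I \<in> P. card I = k} = {I. I \<subseteq> UNIV \<and> card I = k}"
      using k assms(4) by (auto simp: P_def proper_face_index_def)
    then have "card {I \<in> P. card I = k} = n choose k"
      using n_subsets[of "UNIV :: 'n set" k] assms(4) by simp
    moreover have "(-1) ^ card I * X I = (-1) ^ k * X K" if "I \<in> {I \<in> P. card I = k}" for I
      unfolding X_def
      using label_count_equivariant[OF assms(7,6) fine proper, where J = I] that K(2) by (auto simp: P_def)
    ultimately have "(\<Sum>I\<in>{I \<in> P. card I = k}. (-1) ^ card I * X I) = int (n choose k) * ((-1) ^ k * X K)"
      by simp
    moreover have "int p dvd int (n choose k)"
      using prime_dvd_choose_prime_power[OF assms(1)] k assms(3) by simp
    ultimately show "int p dvd (\<Sum>I\<in>{I \<in> P. card I = k}. (-1) ^ card I * X I)"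
      by simp
  qed
  moreover have "(\<Sum>I\<in>P. (-1) ^ card I * X I) = - 1"
  proof -
    have "{} \<notin> insert UNIV P" "UNIV \<notin> P"
      by (auto simp: P_def proper_face_index_def)
    then have "(\<Sum>I\<in>insert {} (insert UNIV P). (-1) ^ card I * X I)
        = 1 + (\<Sum>I\<in>P. (-1) ^ card I * X I)"
      by (simp add: X_empty X_UNIV)
    moreover have "insert {} (insert UNIV P) = UNIV"
      by (auto simp: P_def proper_face_index_def)
    ultimately have "(\<Sum>I\<in>UNIV. (-1) ^ card I * X I) = 1 + (\<Sum>I\<in>P. (-1) ^ card I * X I)"
      by simp
    then show ?thesis using alternating_label_count[of m "label f"] by (simp add: X_def)
  qed
  ultimately show False using assms(1) by (auto simp: int_dvd_int_iff[of p 1, simplified])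
qed

end
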